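(* Let $\Omega\subset\mathbb{R}^s$ be a nonempty set and let $\mathcal C\subset\mathbb{R}^s$ be a nonempty, closed and convex set. Let $\bar x\in\Omega\cap\mathcal C$ and suppose that $\Omega$ is locally closed around $\bar x$. Then the following assertions hold: (i) $N^p_{\mathcal C}(\bar x,\Omega)=\left\{x^*\in\mathbb{R}^s\mid \exists p>0:\ \bar x+px^*\in\mathcal C,\ \langle x^*,x-\bar x\rangle\le\frac{1}{2p}\Vert x-\bar x\Vert^2\ \ \forall x\in\Omega\cap\mathcal C\right\}.$ (ii) $N^p_{\mathcal C}(\bar x,\Omega)=N^p(\bar x,\Omega\cap\mathcal C)\cap\{x^*\in\mathbb{R}^s\mid \exists p>0\text{ such that }\bar x+px^*\in\mathcal C\}.$ Consequently, $$N^p_{\mathcal C}(\bar x,\Omega)=\Big\{x^*\in\mathbb{R}^s\mid \exists\,\theta,\delta,p>0\text{ such that }\bar x+px^*\in\mathcal C\text{ and }\langle x^*,x-\bar x\rangle\le\delta\Vert x-\bar x\Vert^2\ \ \forall x\in\Omega\cap\mathcal C\cap\mathbb{B}(\bar x,\theta)\Big\}.$$ (iii) $N^p_{\mathcal C}(\bar x,\Omega)$ is a convex cone. (iv) $N_{\mathcal C}(\bar x,\Omega)$ is a closed cone. (v) $N_{\mathcal C}(\bar x,\Omega)=\mathop{\mathrm{Lim\,sup}}\limits_{x\to\bar x,\ x\in\mathcal C}\big(\mathrm{cone}[x-\Pi(x,\Omega\cap\mathcal C)]\big).$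
   Context: All spaces are Euclidean; $\mathbb{B}(x,r)$ is the closed ball with center $x$ and radius $r$. $\Omega$ is locally closed around $\bar x$ if there is $r_0>0$ such that $\Omega\cap\mathbb{B}(\bar x,r)$ is closed for all $r\in(0,r_0)$. For $S\subset\mathbb{R}^s$: $\mathrm{cone}(S)=\{\lambda\omega\mid\lambda\ge0,\ \omega\in S\}$; $\Pi(x,S)=\{u\in S\mid\Vert u-x\Vert=\inf_{v\in S}\Vert v-x\Vert\}$ (possibly empty); for $u\in S$, $\Pi^{-1}(u,S)=\{x\in\mathbb{R}^s\mid u\in\Pi(x,S)\}$. The proximal normal cone to $S$ at $\bar x\in S$ is $N^p(\bar x,S)=\mathrm{cone}[\Pi^{-1}(\bar x,S)-\bar x]$. For a set-valued mapping $G$ and a set $D$, $\mathop{\mathrm{Lim\,sup}}_{x\to\bar x,\,x\in D}G(x)$ is the set of all $y$ for which there are $x_k\to\bar x$ with $x_k\in D$ and $y_k\to y$ with $y_k\in G(x_k)$ for all $k\in\mathbb{N}$. For $\mathcal C$ closed convex and $x\in\Omega\cap\mathcal C$, the proximal normal cone to $\Omega$ at $x$ with respect to $\mathcal C$ is $$N^p_{\mathcal C}(x,\Omega)=\{x^*\in\mathbb{R}^s\mid\exists t>0\text{ such that }x+tx^*\in\Pi^{-1}(x,\Omega\cap\mathcal C)\cap\mathcal C\},$$ and the limiting normal cone to $\Omega$ at $\bar x$ with respect to $\mathcal C$ is $N_{\mathcal C}(\bar x,\Omega)=\mathop{\mathrm{Lim\,sup}}_{x\to\bar x,\ x\in\Omega\cap\mathcal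 C}N^p_{\mathcal C}(x,\Omega)$. *)

theory Defs
  imports "HOL-Analysis.Analysis"
begin

definition locally_closed_around :: "'a::metric_space set \<Rightarrow> 'a \<Rightarrow> bool" where
  "locally_closed_around \<Omega> xb \<longleftrightarrow>
     (\<exists>r0>0. \<forall>r. 0 < r \<and> r < r0 \<longrightarrow> closed (\<Omega> \<inter> cball xb r))"

text \<open>The set-valued projection; the library's \<open>closest_point\<close> only selects one element.\<close>

definition proj :: "'a::real_normed_vector \<Rightarrow> 'a set \<Rightarrow> 'a set" where
  "proj x S = {u \<in> S. norm (u - x) = (INF v\<in>S. norm (v - x))}"

text \<open>This is empty for \<open>u \<notin> S\<close>.\<close>

definition proj_inv :: "'a::real_normed_vector \<Rightarrow> 'a set \<Rightarrow> 'a set" where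
  "proj_inv u S = {x. u \<in> proj x S}"

text \<open>
  The cone generated by \<open>S\<close>, i.e. the set of all \<open>\<lambda> \<omega>\<close> with \<open>\<lambda> \<ge> 0\<close> and \<open>\<omega> \<in> S\<close>, is the library's
  \<open>cone hull S\<close> (see \<open>cone_hull_expl\<close>). It is not convexified, and it is empty if \<open>S\<close> is empty.
\<close>

definition prox_normal :: "'a::real_normed_vector \<Rightarrow> 'a set \<Rightarrow> 'a set" where
  "prox_normal xb S = cone hull ((\<lambda>x. x - xb) ` proj_inv xb S)"

text \<open>
  The outer limit of \<open>G\<close> at \<open>xb\<close> relative to \<open>D\<close>. The sequences may take the value \<open>xb\<close> itself.
\<close>

definition Lim_sup ::
  "('a::topological_space \<Rightarrow> 'b::topological_space set) \<Rightarrow> 'a \<Rightarrow> 'a set \<Rightarrow> 'b set" where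
  "Lim_sup G xb D =
     {y. \<exists>X Y. X \<longlonglongrightarrow> xb \<and> Y \<longlonglongrightarrow> y \<and> (\<forall>k::nat. X k \<in> D \<and> Y k \<in> G (X k))}"

definition prox_normal_wrt :: "'a::real_normed_vector set \<Rightarrow> 'a \<Rightarrow> 'a set \<Rightarrow> 'a set" where
  "prox_normal_wrt C x \<Omega> = {xs. \<exists>t>0. x + t *\<^sub>R xs \<in> proj_inv x (\<Omega> \<inter> C) \<inter> C}"

definition lim_normal_wrt :: "'a::real_normed_vector set \<Rightarrow> 'a \<Rightarrow> 'a set \<Rightarrow> 'a set" where
  "lim_normal_wrt C xb \<Omega> = Lim_sup (\<lambda>x. prox_normal_wrt C x \<Omega>) xb (\<Omega> \<inter> C)"

end

theory Submission
  imports Defs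
begin

text \<open>
  Put \<open>S = \<Omega> \<inter> C\<close>. Expanding a square shows that \<open>x\<close> is a nearest point of \<open>S\<close> to \<open>x + t *\<^sub>R xs\<close> iff
  \<open>x \<in> S\<close> and \<open>xs \<bullet> (v - x) \<le> 1 / (2 * t) * (norm (v - x))\<^sup>2\<close> for all \<open>v \<in> S\<close>
  (\<open>proj_inv_step_iff\<close>). This is the description of proximal normals by quadratic inequalities, and it
  weakens as \<open>t\<close> decreases. By convexity of \<open>C\<close>, the condition \<open>x + t *\<^sub>R xs \<in> C\<close> is also inherited by
  smaller \<open>t\<close>. Two step lengths can therefore always be replaced by their minimum: this decouples
  the projection condition from membership in \<open>C\<close>, and it gives closure under addition once the
  quadratic inequality has been localised (\<open>prox_normal_wrt_iff_local\<close>), where constants simply add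
  up. Localisation costs nothing, since away from \<open>x\<close> the Cauchy-Schwarz inequality already
  bounds \<open>xs \<bullet> (v - x)\<close> by a multiple of \<open>(norm (v - x))\<^sup>2\<close>.

  For the limiting cone, an outer limit in metric spaces has an \<open>\<epsilon>\<close>-description
  (\<open>Lim_sup_iff\<close>) from which closedness is immediate. To compare the two outer limits, a proximal
  normal \<open>y\<close> at \<open>u\<close> is realised as a positive multiple of \<open>z - u\<close> with \<open>z = u + s *\<^sub>R y\<close> as close to
  \<open>u\<close> as desired, because \<open>s\<close> may be shrunk; conversely, if \<open>z \<in> C\<close> is close to \<open>xb \<in> S\<close> then so are
  its nearest points in \<open>S\<close>, as they are no farther from \<open>z\<close> than \<open>xb\<close> is.
\<close>

section \<open>Projections and quadratic inequalities\<close>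

lemma proj_iff:
  fixes x u :: "'a::real_normed_vector"
  shows "u \<in> proj x S \<longleftrightarrow> u \<in> S \<and> (\<forall>v\<in>S. norm (u - x) \<le> norm (v - x))"
proof
  assume u: "u \<in> proj x S"
  have "bdd_below ((\<lambda>v. norm (v - x)) ` S)"
    by (rule bdd_belowI[of _ 0]) auto
  then have "(INF v\<in>S. norm (v - x)) \<le> norm (v - x)" if "v \<in> S" for v
    using that by (rule cINF_lower)
  with u show "u \<in> S \<and> (\<forall>v\<in>S. norm (u - x) \<le> norm (v - x))"
    by (auto simp: proj_def)
next
  assume u: "u \<in> S \<and> (\<forall>v\<in>S. norm (u - x) \<le> norm (v - x))"
  then have "(INF v\<in>S. norm (v - x)) = norm (u - x)"
    by (intro cInf_eq_minimum) auto
  with u show "u \<in> proj x S"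
    by (simp add: proj_def)
qed

text \<open>
  Squaring \<open>norm (t *\<^sub>R xs) \<le> norm ((v - x) - t *\<^sub>R xs)\<close> and cancelling \<open>(norm (t *\<^sub>R xs))\<^sup>2\<close> leaves
  an inequality that is linear in \<open>xs\<close>.
\<close>

lemma proj_inv_step_iff:
  fixes x xs :: "'a::real_inner"
  assumes "t > 0"
  shows "x + t *\<^sub>R xs \<in> proj_inv x S \<longleftrightarrow>
    x \<in> S \<and> (\<forall>v\<in>S. xs \<bullet> (v - x) \<le> 1 / (2 * t) * (norm (v - x))\<^sup>2)"
proof -
  have "norm (x - (x + t *\<^sub>R xs)) \<le> norm (v - (x + t *\<^sub>R xs)) \<longleftrightarrow>
      xs \<bullet> (v - x) \<le> 1 / (2 * t) * (norm (v - x))\<^sup>2" for v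
  proof -
    have "norm (x - (x + t *\<^sub>R xs)) \<le> norm (v - (x + t *\<^sub>R xs)) \<longleftrightarrow>
        (norm (t *\<^sub>R xs))\<^sup>2 \<le> (norm ((v - x) - t *\<^sub>R xs))\<^sup>2"
      by (simp add: diff_diff_eq norm_le_square)
    also have "(norm ((v - x) - t *\<^sub>R xs))\<^sup>2 =
        (norm (v - x))\<^sup>2 - 2 * t * (xs \<bullet> (v - x)) + (norm (t *\<^sub>R xs))\<^sup>2"
      unfolding power2_norm_eq_inner
      by (simp only: inner_diff_left inner_diff_right inner_scaleR_left inner_scaleR_right)
        (simp add: inner_commute algebra_simps)
    finally show ?thesis
      using assms by (simp add: field_simps)
  qed
  then show ?thesis
    by (simp add: proj_inv_def proj_iff)
qed

lemma proj_inv_step_mono: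
  fixes x xs :: "'a::real_inner"
  assumes "0 < s" "s \<le> t" and t: "x + t *\<^sub>R xs \<in> proj_inv x S"
  shows "x + s *\<^sub>R xs \<in> proj_inv x S"
proof -
  have "1 / (2 * t) \<le> 1 / (2 * s)"
    using assms(1,2) by (simp add: frac_le)
  then have le: "1 / (2 * t) * (norm (v - x))\<^sup>2 \<le> 1 / (2 * s) * (norm (v - x))\<^sup>2" for v
    by (rule mult_right_mono) simp
  have "t > 0"
    using assms(1,2) by linarith
  with t have "x \<in> S" "\<And>v. v \<in> S \<Longrightarrow> xs \<bullet> (v - x) \<le> 1 / (2 * t) * (norm (v - x))\<^sup>2"
    by (simp_all only: proj_inv_step_iff)
  then show ?thesis
    unfolding proj_inv_step_iff[OF \<open>0 < s\<close>] using le order_trans by blast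
qed

lemma convex_step_mono:
  fixes x xs :: "'a::real_vector"
  assumes "convex C" "x \<in> C" "0 \<le> s" "s \<le> t" "x + t *\<^sub>R xs \<in> C"
  shows "x + s *\<^sub>R xs \<in> C"
proof (cases "t = 0")
  case False
  have "(1 - s / t) *\<^sub>R x + (s / t) *\<^sub>R (x + t *\<^sub>R xs) \<in> C"
    using assms False by (intro convexD) auto
  then show ?thesis
    using False by (simp add: algebra_simps)
qed (use assms in auto)

section \<open>The proximal normal cone relative to a convex set\<close>

lemma prox_normal_wrt_iff:
  fixes x xs :: "'a::real_inner"
  shows "xs \<in> prox_normal_wrt C x \<Omega> \<longleftrightarrow>
    x \<in> \<Omega> \<inter> C \<and> (\<exists>p>0. x + p *\<^sub>R xs \<in> C \<and>
      (\<forall>v\<in>\<Omega> \<inter> C. xs \<bullet> (v - x) \<le> 1 / (2 * p) * (norm (v - x))\<^sup>2))"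
  unfolding prox_normal_wrt_def using proj_inv_step_iff[of _ x xs "\<Omega> \<inter> C"] by blast

text \<open>
  The two step lengths need not agree: by monotonicity in both conditions, their minimum serves
  for both.
\<close>

lemma prox_normal_wrtI:
  fixes x xs :: "'a::real_inner"
  assumes "convex C" "x \<in> C" "0 < p" "x + p *\<^sub>R xs \<in> C"
    and "0 < t" "x + t *\<^sub>R xs \<in> proj_inv x (\<Omega> \<inter> C)"
  shows "xs \<in> prox_normal_wrt C x \<Omega>"
proof -
  have "x + min p t *\<^sub>R xs \<in> C"
    using assms by (intro convex_step_mono[of C x "min p t" p]) auto
  moreover have "x + min p t *\<^sub>R xs \<in> proj_inv x (\<Omega> \<inter> C)"
    using assms by (intro proj_inv_step_mono[of "min p t" t]) auto
  moreover have "min p t > 0"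
    using assms by simp
  ultimately show ?thesis
    unfolding prox_normal_wrt_def by blast
qed

lemma prox_normal_iff:
  fixes x xs :: "'a::real_inner"
  assumes "x \<in> S"
  shows "xs \<in> prox_normal x S \<longleftrightarrow> (\<exists>t>0. x + t *\<^sub>R xs \<in> proj_inv x S)"
proof
  assume "xs \<in> prox_normal x S"
  then obtain c z where c: "c \<ge> 0" and z: "z \<in> proj_inv x S" and xs: "xs = c *\<^sub>R (z - x)"
    by (auto simp: prox_normal_def cone_hull_expl)
  show "\<exists>t>0. x + t *\<^sub>R xs \<in> proj_inv x S"
  proof (cases "c = 0")
    case True
    then show ?thesis
      using assms xs by (intro exI[of _ 1]) (auto simp: proj_inv_def proj_iff)
  next
    case False
    then show ?thesis
      using c z xs by (intro exI[of _ "1 / c"]) auto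
  qed
next
  assume "\<exists>t>0. x + t *\<^sub>R xs \<in> proj_inv x S"
  then obtain t where t: "t > 0" "x + t *\<^sub>R xs \<in> proj_inv x S"
    by blast
  then have "xs = (1 / t) *\<^sub>R ((x + t *\<^sub>R xs) - x)"
    by simp
  with t show "xs \<in> prox_normal x S"
    unfolding prox_normal_def cone_hull_expl mem_Collect_eq
    by (intro exI[of _ "1 / t"] exI[of _ "(x + t *\<^sub>R xs) - x"] conjI imageI) auto
qed

lemma prox_normal_wrt_eq_Int:
  fixes x :: "'a::real_inner"
  assumes "convex C" "x \<in> \<Omega> \<inter> C"
  shows "prox_normal_wrt C x \<Omega> =
    prox_normal x (\<Omega> \<inter> C) \<inter> {xs. \<exists>p>0. x + p *\<^sub>R xs \<in> C}"
proof (intro set_eqI iffI)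
  fix xs
  assume "xs \<in> prox_normal_wrt C x \<Omega>"
  then show "xs \<in> prox_normal x (\<Omega> \<inter> C) \<inter> {xs. \<exists>p>0. x + p *\<^sub>R xs \<in> C}"
    unfolding prox_normal_wrt_def Int_iff mem_Collect_eq prox_normal_iff[OF assms(2)] by blast
next
  fix xs
  assume "xs \<in> prox_normal x (\<Omega> \<inter> C) \<inter> {xs. \<exists>p>0. x + p *\<^sub>R xs \<in> C}"
  then show "xs \<in> prox_normal_wrt C x \<Omega>"
    using assms by (auto simp: prox_normal_iff intro: prox_normal_wrtI)
qed

text \<open>
  Outside the ball of radius \<open>\<theta>\<close> one has
  \<open>xs \<bullet> (v - x) \<le> norm xs * norm (v - x) \<le> norm xs / \<theta> * (norm (v - x))\<^sup>2\<close>, so the inequality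
  near \<open>x\<close> implies the one on all of \<open>\<Omega> \<inter> C\<close>, with constant \<open>max \<delta> (norm xs / \<theta>)\<close>.
\<close>

lemma prox_normal_wrt_iff_local:
  fixes x xs :: "'a::real_inner"
  assumes "convex C" "x \<in> \<Omega> \<inter> C"
  shows "xs \<in> prox_normal_wrt C x \<Omega> \<longleftrightarrow>
    (\<exists>\<theta>>0. \<exists>\<delta>>0. \<exists>p>0. x + p *\<^sub>R xs \<in> C \<and>
      (\<forall>v\<in>\<Omega> \<inter> C \<inter> cball x \<theta>. xs \<bullet> (v - x) \<le> \<delta> * (norm (v - x))\<^sup>2))"
proof
  assume "xs \<in> prox_normal_wrt C x \<Omega>"
  then obtain p where p: "p > 0" "x + p *\<^sub>R xs \<in> C"
    "\<forall>v\<in>\<Omega> \<inter> C. xs \<bullet> (v - x) \<le> 1 / (2 * p) * (norm (v - x))\<^sup>2"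
    unfolding prox_normal_wrt_iff by blast
  show "\<exists>\<theta>>0. \<exists>\<delta>>0. \<exists>p>0. x + p *\<^sub>R xs \<in> C \<and>
      (\<forall>v\<in>\<Omega> \<inter> C \<inter> cball x \<theta>. xs \<bullet> (v - x) \<le> \<delta> * (norm (v - x))\<^sup>2)"
    by (rule exI[of _ 1], simp, rule exI[of _ "1 / (2 * p)"]) (use p in auto)
next
  assume "\<exists>\<theta>>0. \<exists>\<delta>>0. \<exists>p>0. x + p *\<^sub>R xs \<in> C \<and>
      (\<forall>v\<in>\<Omega> \<inter> C \<inter> cball x \<theta>. xs \<bullet> (v - x) \<le> \<delta> * (norm (v - x))\<^sup>2)"
  then obtain \<theta> \<delta> p where pos: "\<theta> > 0" "\<delta> > 0" "p > 0" and p: "x + p *\<^sub>R xs \<in> C"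
    and near: "\<And>v. v \<in> \<Omega> \<inter> C \<Longrightarrow> norm (v - x) \<le> \<theta> \<Longrightarrow> xs \<bullet> (v - x) \<le> \<delta> * (norm (v - x))\<^sup>2"
    by (auto simp: dist_norm norm_minus_commute)
  define K where "K = max \<delta> (norm xs / \<theta>)"
  have "K > 0"
    using pos by (simp add: K_def less_max_iff_disj)
  have "xs \<bullet> (v - x) \<le> K * (norm (v - x))\<^sup>2" if v: "v \<in> \<Omega> \<inter> C" for v
  proof (cases "norm (v - x) \<le> \<theta>")
    case True
    then have "xs \<bullet> (v - x) \<le> \<delta> * (norm (v - x))\<^sup>2"
      using near v by blast
    also have "\<dots> \<le> K * (norm (v - x))\<^sup>2"
      by (intro mult_right_mono) (auto simp: K_def)
    finally show ?thesis .
  next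
    case False
    have "xs \<bullet> (v - x) \<le> norm xs / \<theta> * (\<theta> * norm (v - x))"
      using norm_cauchy_schwarz[of xs "v - x"] pos by simp
    also have "\<dots> \<le> norm xs / \<theta> * (norm (v - x) * norm (v - x))"
      using False pos by (intro mult_left_mono mult_right_mono) auto
    also have "\<dots> \<le> K * (norm (v - x) * norm (v - x))"
      by (intro mult_right_mono) (auto simp: K_def)
    finally show ?thesis
      by (simp add: power2_eq_square)
  qed
  \<comment> \<open>The step length \<open>t\<close> whose constant \<open>1 / (2 * t)\<close> is \<open>K\<close>.\<close>
  then have "x + (1 / (2 * K)) *\<^sub>R xs \<in> proj_inv x (\<Omega> \<inter> C)"
    using \<open>K > 0\<close> assms by (subst proj_inv_step_iff) auto
  then show "xs \<in> prox_normal_wrt C x \<Omega>"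
    using assms pos p \<open>K > 0\<close> by (intro prox_normal_wrtI[of C x p xs "1 / (2 * K)"]) auto
qed

lemma zero_mem_prox_normal_wrt:
  fixes x :: "'a::real_inner"
  assumes "x \<in> \<Omega> \<inter> C"
  shows "0 \<in> prox_normal_wrt C x \<Omega>"
  unfolding prox_normal_wrt_iff using assms by (auto intro: exI[of _ 1])

lemma scaleR_mem_prox_normal_wrt:
  fixes x xs :: "'a::real_inner"
  assumes xs: "xs \<in> prox_normal_wrt C x \<Omega>" and "c \<ge> 0"
  shows "c *\<^sub>R xs \<in> prox_normal_wrt C x \<Omega>"
proof (cases "c = 0")
  case True
  then show ?thesis
    using xs zero_mem_prox_normal_wrt by (auto simp: prox_normal_wrt_iff)
next
  case False
  obtain t where "t > 0" "x + t *\<^sub>R xs \<in> proj_inv x (\<Omega> \<inter> C) \<inter> C"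
    using xs by (auto simp: prox_normal_wrt_def)
  then have "t / c > 0" "x + (t / c) *\<^sub>R (c *\<^sub>R xs) \<in> proj_inv x (\<Omega> \<inter> C) \<inter> C"
    using False \<open>c \<ge> 0\<close> by auto
  then show ?thesis
    unfolding prox_normal_wrt_def by blast
qed

text \<open>
  In the local description the radii combine by their minimum and the constants by their sum;
  for membership in \<open>C\<close>, half the smaller step along \<open>y + z\<close> leads to the midpoint of two points
  of \<open>C\<close>.
\<close>

lemma add_mem_prox_normal_wrt:
  fixes x y z :: "'a::real_inner"
  assumes "convex C" "x \<in> \<Omega> \<inter> C"
    and "y \<in> prox_normal_wrt C x \<Omega>" "z \<in> prox_normal_wrt C x \<Omega>"
  shows "y + z \<in> prox_normal_wrt C x \<Omega>"
proof -
  obtain \<theta>1 \<delta>1 p1 where 1: "\<theta>1 > 0" "\<delta>1 > 0" "p1 > 0" "x + p1 *\<^sub>R y \<in> C"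
    and y: "\<And>v. v \<in> \<Omega> \<inter> C \<inter> cball x \<theta>1 \<Longrightarrow> y \<bullet> (v - x) \<le> \<delta>1 * (norm (v - x))\<^sup>2"
    using assms(3) unfolding prox_normal_wrt_iff_local[OF assms(1,2)] by blast
  obtain \<theta>2 \<delta>2 p2 where 2: "\<theta>2 > 0" "\<delta>2 > 0" "p2 > 0" "x + p2 *\<^sub>R z \<in> C"
    and z: "\<And>v. v \<in> \<Omega> \<inter> C \<inter> cball x \<theta>2 \<Longrightarrow> z \<bullet> (v - x) \<le> \<delta>2 * (norm (v - x))\<^sup>2"
    using assms(4) unfolding prox_normal_wrt_iff_local[OF assms(1,2)] by blast
  define p where "p = min p1 p2"
  have "x + p *\<^sub>R y \<in> C" "x + p *\<^sub>R z \<in> C"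
    using 1 2 assms(1,2) convex_step_mono[of C x p p1 y] convex_step_mono[of C x p p2 z]
    by (auto simp: p_def)
  then have "(1 / 2) *\<^sub>R (x + p *\<^sub>R y) + (1 / 2) *\<^sub>R (x + p *\<^sub>R z) \<in> C"
    by (intro convexD[OF assms(1)]) auto
  also have "(1 / 2) *\<^sub>R (x + p *\<^sub>R y) + (1 / 2) *\<^sub>R (x + p *\<^sub>R z) =
      ((1 / 2) *\<^sub>R x + (1 / 2) *\<^sub>R x) + (p / 2) *\<^sub>R (y + z)"
    by (simp add: scaleR_right_distrib)
  also have "(1 / 2) *\<^sub>R x + (1 / 2) *\<^sub>R x = x"
    by (simp flip: scaleR_left_distrib)
  finally have step: "x + (p / 2) *\<^sub>R (y + z) \<in> C" .
  have "(y + z) \<bullet> (v - x) \<le> (\<delta>1 + \<delta>2) * (norm (v - x))\<^sup>2"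
    if "v \<in> \<Omega> \<inter> C \<inter> cball x (min \<theta>1 \<theta>2)" for v
    using y[of v] z[of v] that by (auto simp: inner_add_left distrib_right)
  moreover have "min \<theta>1 \<theta>2 > 0" "\<delta>1 + \<delta>2 > 0" "p / 2 > 0"
    using 1 2 by (auto simp: p_def)
  ultimately show ?thesis
    unfolding prox_normal_wrt_iff_local[OF assms(1,2)] using step by blast
qed

lemma convex_cone_prox_normal_wrt:
  fixes x :: "'a::real_inner"
  assumes "convex C" "x \<in> \<Omega> \<inter> C"
  shows "convex_cone (prox_normal_wrt C x \<Omega>)"
  unfolding convex_cone_iff using zero_mem_prox_normal_wrt[OF assms(2)]
    scaleR_mem_prox_normal_wrt add_mem_prox_normal_wrt[OF assms]
  by blast

section \<open>Outer limits\<close>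

lemma Lim_sup_iff:
  fixes G :: "'a::metric_space \<Rightarrow> 'b::metric_space set"
  shows "y \<in> Lim_sup G xb D \<longleftrightarrow> (\<forall>e>0. \<exists>x\<in>D. dist x xb < e \<and> (\<exists>z\<in>G x. dist z y < e))"
proof (intro iffI allI impI)
  fix e :: real
  assume "y \<in> Lim_sup G xb D" "e > 0"
  then obtain X Y where XY: "X \<longlonglongrightarrow> xb" "Y \<longlonglongrightarrow> y" "\<And>k. X k \<in> D \<and> Y k \<in> G (X k)"
    by (auto simp: Lim_sup_def)
  have "\<forall>\<^sub>F k in sequentially. dist (X k) xb < e \<and> dist (Y k) y < e"
    using XY \<open>e > 0\<close> by (intro eventually_conj tendstoD)
  then obtain k where "dist (X k) xb < e" "dist (Y k) y < e"
    using eventually_happens' sequentially_bot by blast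
  with XY(3)[of k] show "\<exists>x\<in>D. dist x xb < e \<and> (\<exists>z\<in>G x. dist z y < e)"
    by blast
next
  assume *: "\<forall>e>0. \<exists>x\<in>D. dist x xb < e \<and> (\<exists>z\<in>G x. dist z y < e)"
  have "\<exists>x z. x \<in> D \<and> z \<in> G x \<and>
      dist x xb < inverse (real (Suc k)) \<and> dist z y < inverse (real (Suc k))" for k
    using *[rule_format, of "inverse (real (Suc k))"] by (auto simp del: of_nat_Suc)
  then obtain X Y where XY: "\<And>k. X k \<in> D \<and> Y k \<in> G (X k) \<and>
      dist (X k) xb < inverse (real (Suc k)) \<and> dist (Y k) y < inverse (real (Suc k))"
    by metis
  have "(\<lambda>k. dist (X k) xb) \<longlonglongrightarrow> 0" "(\<lambda>k. dist (Y k) y) \<longlonglongrightarrow> 0"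
    by (rule tendsto_sandwich[OF _ _ tendsto_const LIMSEQ_inverse_real_of_nat];
        use XY in \<open>auto intro!: always_eventually less_imp_le\<close>)+
  then have "X \<longlonglongrightarrow> xb" "Y \<longlonglongrightarrow> y"
    by (simp_all only: tendsto_dist_iff[symmetric])
  with XY show "y \<in> Lim_sup G xb D"
    unfolding Lim_sup_def by blast
qed

text \<open>The \<open>\<epsilon>\<close>-description replaces the diagonal sequence that the definition would call for.\<close>

lemma closed_Lim_sup:
  fixes G :: "'a::metric_space \<Rightarrow> 'b::metric_space set"
  shows "closed (Lim_sup G xb D)"
proof -
  have "y \<in> Lim_sup G xb D" if y: "y \<in> closure (Lim_sup G xb D)" for y
    unfolding Lim_sup_iff
  proof (intro allI impI)
    fix e :: real
    assume "e > 0"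
    then obtain y' where y': "y' \<in> Lim_sup G xb D" "dist y' y < e / 2"
      using y by (meson closure_approachable half_gt_zero)
    then obtain x z where "x \<in> D" "dist x xb < e / 2" "z \<in> G x" "dist z y' < e / 2"
      using \<open>e > 0\<close> unfolding Lim_sup_iff by (meson half_gt_zero)
    moreover from this y' have "dist z y < e"
      using dist_triangle[of z y y'] by linarith
    ultimately show "\<exists>x\<in>D. dist x xb < e \<and> (\<exists>z\<in>G x. dist z y < e)"
      using \<open>e > 0\<close> by (intro bexI[of _ x] conjI bexI[of _ z]) auto
  qed
  then show ?thesis
    by (metis closure_subset_eq subsetI)
qed

lemma cone_Lim_sup:
  fixes G :: "'a::topological_space \<Rightarrow> 'b::real_normed_vector set"
  assumes "\<And>x. x \<in> D \<Longrightarrow> cone (G x)"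
  shows "cone (Lim_sup G xb D)"
  unfolding cone_def
proof (intro ballI allI impI)
  fix y and c :: real
  assume "y \<in> Lim_sup G xb D" "0 \<le> c"
  then obtain X Y where XY: "X \<longlonglongrightarrow> xb" "Y \<longlonglongrightarrow> y" "\<forall>k. X k \<in> D \<and> Y k \<in> G (X k)"
    by (auto simp: Lim_sup_def)
  have "(\<lambda>k. c *\<^sub>R Y k) \<longlonglongrightarrow> c *\<^sub>R y"
    using XY(2) by (intro tendsto_intros)
  moreover have "c *\<^sub>R Y k \<in> G (X k)" for k
    using XY(3) assms \<open>0 \<le> c\<close> by (simp add: mem_cone)
  ultimately show "c *\<^sub>R y \<in> Lim_sup G xb D"
    using XY unfolding Lim_sup_def by blast
qed

section \<open>The limiting normal cone relative to a convex set\<close>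

lemma zero_mem_lim_normal_wrt:
  fixes xb :: "'a::real_inner"
  assumes "xb \<in> \<Omega> \<inter> C"
  shows "0 \<in> lim_normal_wrt C xb \<Omega>"
  unfolding lim_normal_wrt_def Lim_sup_iff
proof (intro allI impI)
  fix e :: real
  assume "e > 0"
  then show "\<exists>x\<in>\<Omega> \<inter> C. dist x xb < e \<and> (\<exists>z\<in>prox_normal_wrt C x \<Omega>. dist z 0 < e)"
    using assms by (intro bexI[of _ xb] conjI bexI[of _ 0] zero_mem_prox_normal_wrt) auto
qed

lemma cone_prox_normal_wrt:
  fixes x :: "'a::real_inner"
  shows "cone (prox_normal_wrt C x \<Omega>)"
  by (simp add: cone_def scaleR_mem_prox_normal_wrt)

text \<open>
  A proximal normal at \<open>u\<close> comes from steps of arbitrarily small length, hence from points \<open>z\<close> of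
  \<open>C\<close> arbitrarily close to \<open>u\<close>.
\<close>

lemma prox_normal_wrt_imp_near_proj:
  fixes u y :: "'a::real_inner"
  assumes "convex C" "y \<in> prox_normal_wrt C u \<Omega>" "e > 0"
  shows "\<exists>z\<in>C. dist z u < e \<and> y \<in> cone hull ((\<lambda>w. z - w) ` proj z (\<Omega> \<inter> C))"
proof -
  obtain t where t: "t > 0" "u + t *\<^sub>R y \<in> proj_inv u (\<Omega> \<inter> C)" "u + t *\<^sub>R y \<in> C"
    using assms(2) by (auto simp: prox_normal_wrt_def)
  have "u \<in> C"
    using assms(2) by (simp add: prox_normal_wrt_iff)
  \<comment> \<open>The summand \<open>1\<close> keeps the denominator positive when \<open>y = 0\<close>.\<close>
  define s where "s = min t (e / (norm y + 1))"
  have den: "norm y + 1 > 0"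
    by (rule add_nonneg_pos) auto
  then have s: "s > 0" "s \<le> t"
    using t \<open>e > 0\<close> by (auto simp: s_def)
  define z where "z = u + s *\<^sub>R y"
  have "s * norm y < s * (norm y + 1)"
    using s by simp
  also have "\<dots> \<le> e / (norm y + 1) * (norm y + 1)"
    using den by (intro mult_right_mono) (auto simp: s_def)
  also have "\<dots> = e"
    using den by simp
  finally have "dist z u < e"
    using s by (simp add: z_def dist_norm)
  moreover have "z \<in> C"
    unfolding z_def using s t \<open>u \<in> C\<close> by (intro convex_step_mono[OF assms(1), of u s t]) auto
  moreover have "u \<in> proj z (\<Omega> \<inter> C)"
    using proj_inv_step_mono[OF s t(2)] by (simp add: z_def proj_inv_def)
  then have "y \<in> cone hull ((\<lambda>w. z - w) ` proj z (\<Omega> \<inter> C))"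
    unfolding cone_hull_expl mem_Collect_eq
    using s by (intro exI[of _ "1 / s"] exI[of _ "z - u"] conjI imageI) (auto simp: z_def)
  ultimately show ?thesis
    by blast
qed

lemma proj_imp_prox_normal_wrt:
  fixes u z :: "'a::real_inner"
  assumes "z \<in> C" "u \<in> proj z (\<Omega> \<inter> C)" "c \<ge> 0"
  shows "c *\<^sub>R (z - u) \<in> prox_normal_wrt C u \<Omega>"
proof (rule scaleR_mem_prox_normal_wrt[OF _ \<open>c \<ge> 0\<close>])
  show "z - u \<in> prox_normal_wrt C u \<Omega>"
    unfolding prox_normal_wrt_def using assms by (auto simp: proj_inv_def intro!: exI[of _ 1])
qed

lemma dist_proj_le:
  fixes u z :: "'a::real_normed_vector"
  assumes "u \<in> proj z S" "x \<in> S"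
  shows "dist u x \<le> 2 * dist z x"
proof -
  have "dist u z \<le> dist z x"
    using assms by (simp add: proj_iff dist_norm norm_minus_commute)
  then show ?thesis
    using dist_triangle[of u x z] by linarith
qed

lemma lim_normal_wrt_eq_Lim_sup_proj:
  fixes xb :: "'a::real_inner"
  assumes "convex C" "xb \<in> \<Omega> \<inter> C"
  shows "lim_normal_wrt C xb \<Omega> =
    Lim_sup (\<lambda>x. cone hull ((\<lambda>u. x - u) ` proj x (\<Omega> \<inter> C))) xb C"
proof (intro set_eqI iffI)
  fix y
  assume y: "y \<in> lim_normal_wrt C xb \<Omega>"
  show "y \<in> Lim_sup (\<lambda>x. cone hull ((\<lambda>u. x - u) ` proj x (\<Omega> \<inter> C))) xb C"
    unfolding Lim_sup_iff
  proof (intro allI impI)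
    fix e :: real
    assume "e > 0"
    then obtain u y' where u: "dist u xb < e / 2" "y' \<in> prox_normal_wrt C u \<Omega>" "dist y' y < e / 2"
      using y unfolding lim_normal_wrt_def Lim_sup_iff by (meson half_gt_zero)
    obtain z where z: "z \<in> C" "dist z u < e / 2"
      "y' \<in> cone hull ((\<lambda>w. z - w) ` proj z (\<Omega> \<inter> C))"
      using prox_normal_wrt_imp_near_proj[OF assms(1) u(2)] \<open>e > 0\<close> by (meson half_gt_zero)
    have "dist z xb < e"
      using z(2) u(1) dist_triangle[of z xb u] by linarith
    with z u \<open>e > 0\<close> show "\<exists>x\<in>C. dist x xb < e \<and>
        (\<exists>z\<in>cone hull ((\<lambda>u. x - u) ` proj x (\<Omega> \<inter> C)). dist z y < e)"
      by (intro bexI[of _ z] conjI bexI[of _ y']) auto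
  qed
next
  fix y
  assume y: "y \<in> Lim_sup (\<lambda>x. cone hull ((\<lambda>u. x - u) ` proj x (\<Omega> \<inter> C))) xb C"
  show "y \<in> lim_normal_wrt C xb \<Omega>"
    unfolding lim_normal_wrt_def Lim_sup_iff
  proof (intro allI impI)
    fix e :: real
    assume "e > 0"
    then obtain z y' where z: "z \<in> C" "dist z xb < e / 2" "dist y' y < e / 2"
      and "y' \<in> cone hull ((\<lambda>u. z - u) ` proj z (\<Omega> \<inter> C))"
      using y unfolding Lim_sup_iff by (meson half_gt_zero)
    then obtain c u where c: "c \<ge> 0" "u \<in> proj z (\<Omega> \<inter> C)" "y' = c *\<^sub>R (z - u)"
      by (auto simp: cone_hull_expl)
    have "dist u xb < e"
      using dist_proj_le[OF c(2) assms(2)] z(2) by linarith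
    moreover have "y' \<in> prox_normal_wrt C u \<Omega>"
      using proj_imp_prox_normal_wrt[OF z(1) c(2,1)] c(3) by simp
    moreover have "u \<in> \<Omega> \<inter> C"
      using c(2) by (simp add: proj_iff)
    ultimately show "\<exists>x\<in>\<Omega> \<inter> C. dist x xb < e \<and> (\<exists>z\<in>prox_normal_wrt C x \<Omega>. dist z y < e)"
      using z(3) \<open>e > 0\<close> by (intro bexI[of _ u] conjI bexI[of _ y']) auto
  qed
qed

section \<open>Properties of the proximal and limiting normal cones\<close>

theorem proposition1:
  fixes \<Omega> C :: "'a::euclidean_space set" and xb :: 'a
  assumes "\<Omega> \<noteq> {}"
    and "C \<noteq> {}" and "closed C" and "convex C"
    and "xb \<in> \<Omega> \<inter> C"
    and "locally_closed_around \<Omega> xb"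
  shows
    "prox_normal_wrt C xb \<Omega> =
       {xs. \<exists>p>0. xb + p *\<^sub>R xs \<in> C \<and>
          (\<forall>x\<in>\<Omega> \<inter> C. xs \<bullet> (x - xb) \<le> 1 / (2 * p) * (norm (x - xb))\<^sup>2)} \<and>
     prox_normal_wrt C xb \<Omega> =
       prox_normal xb (\<Omega> \<inter> C) \<inter> {xs. \<exists>p>0. xb + p *\<^sub>R xs \<in> C} \<and>
     prox_normal_wrt C xb \<Omega> =
       {xs. \<exists>\<theta>>0. \<exists>\<delta>>0. \<exists>p>0. xb + p *\<^sub>R xs \<in> C \<and>
          (\<forall>x\<in>\<Omega> \<inter> C \<inter> cball xb \<theta>. xs \<bullet> (x - xb) \<le> \<delta> * (norm (x - xb))\<^sup>2)} \<and>
     convex_cone (prox_normal_wrt C xb \<Omega>) \<and>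
     (closed (lim_normal_wrt C xb \<Omega>) \<and>
      lim_normal_wrt C xb \<Omega> \<noteq> {} \<and> cone (lim_normal_wrt C xb \<Omega>)) \<and>
     lim_normal_wrt C xb \<Omega> =
       Lim_sup (\<lambda>x. cone hull ((\<lambda>u. x - u) ` proj x (\<Omega> \<inter> C))) xb C"
proof (intro conjI)
  show "prox_normal_wrt C xb \<Omega> =
      {xs. \<exists>p>0. xb + p *\<^sub>R xs \<in> C \<and>
        (\<forall>x\<in>\<Omega> \<inter> C. xs \<bullet> (x - xb) \<le> 1 / (2 * p) * (norm (x - xb))\<^sup>2)}"
    by (rule set_eqI) (simp only: prox_normal_wrt_iff mem_Collect_eq \<open>xb \<in> \<Omega> \<inter> C\<close> simp_thms)
  show "prox_normal_wrt C xb \<Omega> =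
      prox_normal xb (\<Omega> \<inter> C) \<inter> {xs. \<exists>p>0. xb + p *\<^sub>R xs \<in> C}"
    by (intro prox_normal_wrt_eq_Int assms)
  show "prox_normal_wrt C xb \<Omega> =
      {xs. \<exists>\<theta>>0. \<exists>\<delta>>0. \<exists>p>0. xb + p *\<^sub>R xs \<in> C \<and>
        (\<forall>x\<in>\<Omega> \<inter> C \<inter> cball xb \<theta>. xs \<bullet> (x - xb) \<le> \<delta> * (norm (x - xb))\<^sup>2)}"
    by (rule set_eqI)
      (simp only: prox_normal_wrt_iff_local[OF \<open>convex C\<close> \<open>xb \<in> \<Omega> \<inter> C\<close>] mem_Collect_eq)
  show "convex_cone (prox_normal_wrt C xb \<Omega>)"
    by (intro convex_cone_prox_normal_wrt assms)
  show "closed (lim_normal_wrt C xb \<Omega>)"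
    unfolding lim_normal_wrt_def by (rule closed_Lim_sup)
  show "lim_normal_wrt C xb \<Omega> \<noteq> {}"
    using zero_mem_lim_normal_wrt[OF \<open>xb \<in> \<Omega> \<inter> C\<close>] by blast
  show "cone (lim_normal_wrt C xb \<Omega>)"
    unfolding lim_normal_wrt_def by (intro cone_Lim_sup cone_prox_normal_wrt)
  show "lim_normal_wrt C xb \<Omega> =
      Lim_sup (\<lambda>x. cone hull ((\<lambda>u. x - u) ` proj x (\<Omega> \<inter> C))) xb C"
    by (intro lim_normal_wrt_eq_Lim_sup_proj assms)
qed

end
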